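(* For every $t\ge0$, the rhmsp $X$ is $H(t)$-localizable at $t$ with local version $Z^{H(t)}$, i.e. $$\Big\{\delta^{-H(t)}\big(X(t+\delta u)-X(t)\big),\ u\ge0\Big\}\longrightarrow\{Z^{H(t)}(u),\ u\ge0\},\quad\delta\to0+,$$ in the sense of convergence of finite-dimensional distributions.
   Context: Fix $\alpha\in(1,2)$. $M$ is an independently scattered rotationally invariant complex S$\alpha$S random measure on $\mathbb R$ with Lebesgue control measure: for every Borel $A$ and $\theta\in\mathbb R$, $e^{i\theta}M(A)\overset{d}{=}M(A)$, $\mathbb E e^{iu\,\mathrm{Re} M(A)}=e^{-\lambda(A)|u|^\alpha}$; values on disjoint Borel subsets of $[0,\infty)$ are independent; $M(-A)=\overline{M(A)}$. For $f$ with $f(-x)=\overline{f(x)}$, $f\in L^\alpha(\mathbb R)$, $\int f\,dM$ is real S$\alpha$S with $\mathbb E\exp(iu\int f dM)=\exp(-|u|^\alpha\|f\|^\alpha_{L^\alpha})$. For $H\in(0,1)$, $Z^H(u)=\int_{\mathbb R}\frac{e^{iux}-1}{|x|^{1/\alpha+H}}M(dx)$. The Hurst function $H:[0,\infty)\to\mathbb R$ satisfies $0<\hat H:=\inf H\le\sup H=:\check H<1$ and $|H(t)-H(s)|\le C|t-s|^\gamma$ for some $C>0$, $\gamma>\check H$ and all $t,s\ge0$. The rhmsp is $X(t)=\int_{\mathbb R}\frac{e^{itx}-1}{|x|^{1/\alpha+H(t)}}M(dx)$, $t\ge0$. *)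

theory Defs
  imports "HOL-Probability.Probability"
begin

text \<open>Integrand of the harmonizable representation:
  f_{h,t}(x) = (e^{itx} - 1) / |x|^{1/alpha + h}  (the value at x = 0 is irrelevant, a null set).\<close>
definition hms_kernel :: "real \<Rightarrow> real \<Rightarrow> real \<Rightarrow> real \<Rightarrow> complex" where
  "hms_kernel \<alpha> h t x = (cis (t * x) - 1) / complex_of_real (\<bar>x\<bar> powr (1 / \<alpha> + h))"

text \<open>X (on the probability space P) has the law of the process
  t |-> int (e^{itx}-1)/|x|^{1/alpha+H(t)} M(dx), t >= 0, where M is the rotationally
  invariant complex S-alpha-S random measure with Lebesgue control measure:
  by linearity of the stochastic integral and the formula for the characteristic
  function of int f dM, for all t_1..t_n >= 0 and reals a_1..a_n
  E exp(i sum a_j X(t_j)) = exp(- int |sum a_j f_{H(t_j),t_j}(x)|^alpha dx).\<close>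
definition has_rhmsp_law :: "'a measure \<Rightarrow> real \<Rightarrow> (real \<Rightarrow> real) \<Rightarrow> (real \<Rightarrow> 'a \<Rightarrow> real) \<Rightarrow> bool" where
  "has_rhmsp_law P \<alpha> H X \<longleftrightarrow>
     (\<forall>t\<ge>0. X t \<in> borel_measurable P) \<and>
     (\<forall>(n::nat) (s::nat \<Rightarrow> real) (a::nat \<Rightarrow> real). (\<forall>j<n. 0 \<le> s j) \<longrightarrow>
        (\<integral>\<omega>. cis (\<Sum>j<n. a j * X (s j) \<omega>) \<partial>P) =
        complex_of_real (exp (- (\<integral>x. \<bar>cmod (\<Sum>j<n. complex_of_real (a j) * hms_kernel \<alpha> (H (s j)) (s j) x)\<bar> powr \<alpha> \<partial>lborel))))"

text \<open>Convergence of finite-dimensional distributions, as delta -> 0+, of the family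
  of processes Y delta (on P) to the process Z (on Q), both indexed by u >= 0:
  for every finite family u_0..u_{n-1} >= 0 the random vectors (Y delta (u_j))_{j<n}
  converge in distribution to (Z (u_j))_{j<n}, i.e. E g(...) converges for every bounded
  continuous g. Vectors of R^n are encoded as functions nat => real that vanish from n on.\<close>
definition fdd_converges_at_right0 ::
  "'a measure \<Rightarrow> (real \<Rightarrow> real \<Rightarrow> 'a \<Rightarrow> real) \<Rightarrow> 'b measure \<Rightarrow> (real \<Rightarrow> 'b \<Rightarrow> real) \<Rightarrow> bool" where
  "fdd_converges_at_right0 P Y Q Z \<longleftrightarrow>
     (\<forall>(n::nat) (u::nat \<Rightarrow> real). (\<forall>j<n. 0 \<le> u j) \<longrightarrow>
       (\<forall>g :: (nat \<Rightarrow> real) \<Rightarrow> real. continuous_on UNIV g \<and> bounded (range g) \<longrightarrow>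
          ((\<lambda>\<delta>. \<integral>\<omega>. g (\<lambda>j. if j < n then Y \<delta> (u j) \<omega> else 0) \<partial>P)
             \<longlongrightarrow> (\<integral>\<omega>. g (\<lambda>j. if j < n then Z (u j) \<omega> else 0) \<partial>Q)) (at_right 0)))"

end

theory Submission
  imports Defs
begin

text \<open>By a continuity theorem for characteristic functions of random vectors it suffices to show
  that the \<open>L\<^sup>\<alpha>\<close> norm of the kernel of \<open>\<Sum>\<^sub>j a\<^sub>j \<delta>\<^sup>-\<^sup>h (X (t + \<delta> u\<^sub>j) - X t)\<close>, with \<open>h = H t\<close>, converges.
  Split that kernel as \<open>A + B\<close>, where \<open>A\<close> uses the constant exponent \<open>h\<close> throughout and \<open>B\<close> collects the
  changes of exponent from \<open>h\<close> to \<open>H (t + \<delta> u\<^sub>j)\<close>. Stationarity and self-similarity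
  (substituting \<open>\<delta> x\<close>) make the norm of \<open>A\<close> equal to that of the limiting kernel for every \<open>\<delta>\<close>, while
  the Hoelder condition bounds \<open>B\<close> pointwise by \<open>\<delta>\<^sup>\<gamma>\<^sup>-\<^sup>h\<close> times a fixed function in \<open>L\<^sup>\<alpha>\<close>.\<close>

section \<open>A continuity theorem for characteristic functions of random vectors\<close>

lemma cis_measurable [measurable]: "cis \<in> borel_measurable borel"
proof -
  have cis: "cis = (\<lambda>x. exp (\<i> * of_real x))" by (simp add: fun_eq_iff cis_conv_exp)
  show ?thesis unfolding cis by measurable
qed

text \<open>The frequencies are arbitrary reals, and the phase \<open>b\<close> brings in the sines.
  Expectations of such functions are determined by the joint characteristic function of the first
  \<open>n\<close> coordinates.\<close>

inductive trig_poly :: "nat \<Rightarrow> ((nat \<Rightarrow> real) \<Rightarrow> real) \<Rightarrow> bool" for n where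
  cos: "trig_poly n (\<lambda>x. c * cos ((\<Sum>j<n. a j * x j) + b))"
| add: "trig_poly n p \<Longrightarrow> trig_poly n q \<Longrightarrow> trig_poly n (\<lambda>x. p x + q x)"

lemma trig_poly_const: "trig_poly n (\<lambda>_. c)"
  using trig_poly.cos[of n c "\<lambda>_. 0" 0] by simp

lemma trig_poly_sin_coord:
  assumes "i < n"
  shows "trig_poly n (\<lambda>x. sin (c * x i))"
proof -
  have "(\<Sum>j<n. (if j = i then c else 0) * x j) = c * x i" for x :: "nat \<Rightarrow> real"
    using assms by (simp add: if_distrib[of "\<lambda>y. y * _"] cong: if_cong)
  moreover have "cos (c * x i + - (pi/2)) = sin (c * x i)" for x :: "nat \<Rightarrow> real"
    by (simp only: cos_add) simp
  ultimately show ?thesis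
    using trig_poly.cos[of n 1 "\<lambda>j. if j = i then c else 0" "-(pi/2)"] by (simp only: mult_1)
qed

text \<open>The product-to-sum formula settles two single waves; the nested inductions extend it by
  distributivity. Closure under products is what Stone-Weierstrass asks for.\<close>

lemma trig_poly_mult:
  assumes "trig_poly n p" "trig_poly n q"
  shows "trig_poly n (\<lambda>x. p x * q x)"
  using assms(1)
proof induction
  case (cos c a b)
  show ?case using assms(2)
  proof induction
    case (cos c' a' b')
    have eq: "c * cos ((\<Sum>j<n. a j * x j) + b) * (c' * cos ((\<Sum>j<n. a' j * x j) + b'))
      = (c * c' / 2) * cos ((\<Sum>j<n. (a j - a' j) * x j) + (b - b'))
        + (c * c' / 2) * cos ((\<Sum>j<n. (a j + a' j) * x j) + (b + b'))" for x :: "nat \<Rightarrow> real"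
    proof -
      define u v where "u = (\<Sum>j<n. a j * x j) + b" and "v = (\<Sum>j<n. a' j * x j) + b'"
      have "(\<Sum>j<n. (a j - a' j) * x j) + (b - b') = u - v"
        "(\<Sum>j<n. (a j + a' j) * x j) + (b + b') = u + v"
        by (simp_all add: u_def v_def algebra_simps sum.distrib sum_subtractf)
      moreover have "c * cos u * (c' * cos v) = (c * c' / 2) * cos (u - v) + (c * c' / 2) * cos (u + v)"
        unfolding cos_add cos_diff by (simp add: distrib_left right_diff_distrib)
      ultimately show ?thesis
        unfolding u_def[symmetric] v_def[symmetric] by presburger
    qed
    show ?case unfolding eq by (intro trig_poly.intros)
  next
    case (add p' q')
    then show ?case by (simp add: distrib_left trig_poly.add)
  qed
next
  case (add p q)
  then show ?case by (simp add: distrib_right trig_poly.add)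
qed

lemma trig_poly_continuous: "trig_poly n p \<Longrightarrow> continuous_on UNIV p"
  by (induction rule: trig_poly.induct) (auto intro!: continuous_intros)

lemma trig_poly_bounded: "trig_poly n p \<Longrightarrow> \<exists>B. \<forall>x. \<bar>p x\<bar> \<le> B"
proof (induction rule: trig_poly.induct)
  case (cos c a b)
  have "\<bar>c * cos y\<bar> \<le> \<bar>c\<bar>" for y :: real
    by (simp add: abs_mult mult_left_le)
  then show ?case by blast
next
  case (add p q)
  then obtain B C where "\<forall>x. \<bar>p x\<bar> \<le> B" "\<forall>x. \<bar>q x\<bar> \<le> C" by blast
  then have "\<forall>x. \<bar>p x + q x\<bar> \<le> B + C" by (metis abs_triangle_ineq add_mono order_trans)
  then show ?case by blast
qed

lemma integrable_bounded_continuous: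
  fixes g :: "(nat \<Rightarrow> real) \<Rightarrow> real"
  assumes "prob_space M" "Y \<in> borel_measurable M" "continuous_on UNIV g" "\<And>x. \<bar>g x\<bar> \<le> B"
  shows "integrable M (\<lambda>\<omega>. g (Y \<omega>))"
proof -
  interpret prob_space M by fact
  have "g \<in> borel_measurable borel" using assms(3) by (rule borel_measurable_continuous_onI)
  from measurable_compose[OF assms(2) this] show ?thesis
    by (intro integrable_const_bound[where B=B]) (auto simp: assms(4))
qed

text \<open>The wave is \<open>c\<close> times the real part of
  \<open>cis b * cis (Y \<omega>)\<close>, so its expectation is a continuous function of one value
  of the characteristic function.\<close>

lemma integral_trig_wave:
  fixes Y :: "'a \<Rightarrow> real"
  assumes "prob_space M" "Y \<in> borel_measurable M"
  shows "(\<integral>\<omega>. c * cos (Y \<omega> + b) \<partial>M) = c * Re (cis b * (\<integral>\<omega>. cis (Y \<omega>) \<partial>M))"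
proof -
  interpret prob_space M by fact
  have i: "integrable M (\<lambda>\<omega>. cis (Y \<omega>))"
    using assms(2) by (intro integrable_const_bound[where B=1]) auto
  then have "Re (cis b * (\<integral>\<omega>. cis (Y \<omega>) \<partial>M)) = Re (\<integral>\<omega>. cis b * cis (Y \<omega>) \<partial>M)"
    by simp
  also have "\<dots> = (\<integral>\<omega>. Re (cis b * cis (Y \<omega>)) \<partial>M)"
    using i by (intro integral_Re[symmetric]) simp
  also have "\<dots> = (\<integral>\<omega>. cos (Y \<omega> + b) \<partial>M)"
    by (simp only: cis_mult cis.sel add.commute)
  finally show ?thesis by simp
qed

lemma measurable_coord:
  fixes Y :: "'a \<Rightarrow> nat \<Rightarrow> real"
  assumes "Y \<in> borel_measurable M"
  shows "(\<lambda>\<omega>. Y \<omega> j) \<in> borel_measurable M"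
  by (rule measurable_compose[OF assms, where g="\<lambda>x. x j"])
     (intro borel_measurable_continuous_onI continuous_on_product_coordinates)

text \<open>For a single wave this is the assumed convergence of characteristic functions.
  Boundedness supplies the integrability that lets sums be split.\<close>

lemma trig_poly_tendsto:
  fixes Y :: "nat \<Rightarrow> 'a \<Rightarrow> nat \<Rightarrow> real" and W :: "'b \<Rightarrow> nat \<Rightarrow> real"
  assumes M: "\<And>k. prob_space (M k)" and Q: "prob_space Q"
    and Y: "\<And>k. Y k \<in> borel_measurable (M k)" and W: "W \<in> borel_measurable Q"
    and conv: "\<And>a. (\<lambda>k. \<integral>\<omega>. cis (\<Sum>j<n. a j * Y k \<omega> j) \<partial>M k)
                 \<longlonglongrightarrow> (\<integral>\<omega>. cis (\<Sum>j<n. a j * W \<omega> j) \<partial>Q)"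
    and "trig_poly n p"
  shows "(\<lambda>k. \<integral>\<omega>. p (Y k \<omega>) \<partial>M k) \<longlonglongrightarrow> (\<integral>\<omega>. p (W \<omega>) \<partial>Q)"
  using assms(6)
proof induction
  case (cos c a b)
  have "(\<lambda>\<omega>. \<Sum>j<n. a j * Y k \<omega> j) \<in> borel_measurable (M k)" for k
    using measurable_coord[OF Y, of k] by measurable
  moreover have "(\<lambda>\<omega>. \<Sum>j<n. a j * W \<omega> j) \<in> borel_measurable Q"
    using measurable_coord[OF W] by measurable
  ultimately show ?case
    by (simp only: integral_trig_wave[OF M] integral_trig_wave[OF Q])
       (intro tendsto_intros conv)
next
  case (add p q)
  obtain B B' where B: "\<And>x. \<bar>p x\<bar> \<le> B" "\<And>x. \<bar>q x\<bar> \<le> B'"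
    using trig_poly_bounded add.hyps by metis
  note c = trig_poly_continuous[OF add.hyps(1)] trig_poly_continuous[OF add.hyps(2)]
  have "(\<integral>\<omega>. p (Y k \<omega>) + q (Y k \<omega>) \<partial>M k) = (\<integral>\<omega>. p (Y k \<omega>) \<partial>M k) + (\<integral>\<omega>. q (Y k \<omega>) \<partial>M k)" for k
    using integrable_bounded_continuous[OF M Y c(1) B(1)] integrable_bounded_continuous[OF M Y c(2) B(2)]
    by (rule Bochner_Integration.integral_add)
  moreover have "(\<integral>\<omega>. p (W \<omega>) + q (W \<omega>) \<partial>Q) = (\<integral>\<omega>. p (W \<omega>) \<partial>Q) + (\<integral>\<omega>. q (W \<omega>) \<partial>Q)"
    using integrable_bounded_continuous[OF Q W c(1) B(1)] integrable_bounded_continuous[OF Q W c(2) B(2)]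
    by (rule Bochner_Integration.integral_add)
  ultimately show ?case using add.IH by (simp add: tendsto_add)
qed

section \<open>Trigonometric approximation of a continuous function folded onto a cube\<close>

lemma compact_product_real:
  fixes A :: "nat \<Rightarrow> real set"
  assumes "\<And>j. compact (A j)"
  shows "compact {x. \<forall>j. x j \<in> A j}"
proof -
  have "compactin (product_topology (\<lambda>_. euclidean) UNIV) (PiE UNIV A)"
    by (subst compactin_PiE) (simp add: assms)
  moreover have "PiE UNIV A = {x. \<forall>j. x j \<in> A j}" by (auto simp: PiE_def Pi_def)
  ultimately show ?thesis by (simp add: euclidean_product_topology)
qed

text \<open>The arcsine turns approximation on a cube into approximation by polynomials in the functions
  \<open>sin (\<pi> x\<^sub>j / 2K)\<close>, so that the approximant is automatically controlled on the whole space.\<close>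

definition fold_coords :: "real \<Rightarrow> (nat \<Rightarrow> real) \<Rightarrow> nat \<Rightarrow> real" where
  "fold_coords K x = (\<lambda>j. 2 * K / pi * arcsin (sin (pi / (2 * K) * x j)))"

text \<open>For \<open>0 < K\<close> the fold is a triangular wave with values in [-K, K] in each
  coordinate. On the cube the rescaled argument stays in [-pi/2, pi/2], where \<open>arcsin\<close>
  inverts \<open>sin\<close>.\<close>

lemma fold_coords_eq:
  assumes "0 < K" "\<And>j. \<bar>x j\<bar> \<le> K"
  shows "fold_coords K x = x"
proof
  fix j
  have "\<bar>pi / (2 * K) * x j\<bar> = pi / 2 * (\<bar>x j\<bar> / K)" using assms(1) by (simp add: abs_mult)
  also have "\<dots> \<le> pi / 2 * 1" using assms by (intro mult_left_mono) (auto simp: divide_le_eq_1)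
  finally have "arcsin (sin (pi / (2 * K) * x j)) = pi / (2 * K) * x j"
    by (intro arcsin_sin) linarith+
  then show "fold_coords K x j = x j" using assms(1) by (simp add: fold_coords_def)
qed

text \<open>Stone-Weierstrass is applied to the vector of sines rather than to \<open>x\<close>
  itself. Sines lie in [-1, 1] for every real argument, so the estimate is global in
  \<open>x\<close>.\<close>

lemma trig_poly_approx_fold:
  fixes g :: "(nat \<Rightarrow> real) \<Rightarrow> real"
  assumes g: "continuous_on UNIV g" and e: "0 < e"
  obtains p where "trig_poly n p"
    "\<And>x. (\<And>j. j \<ge> n \<Longrightarrow> x j = 0) \<Longrightarrow> \<bar>g (fold_coords K x) - p x\<bar> < e"
proof -
  \<comment> \<open>Pinning the coordinates from \<open>n\<close> on to 0 matches the encoding of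
    vectors: distinct points of \<open>S\<close> differ at an index below \<open>n\<close>, where a
    coordinate function from \<open>R\<close> separates them.\<close>
  define S where "S = {s :: nat \<Rightarrow> real. \<forall>j. s j \<in> (if j < n then {-1..1} else {0})}"
  \<comment> \<open>The ring consists of functions of the sine values; membership is tested after
    composing with the sines, where products of trigonometric polynomials are available.\<close>
  define R where "R = {q :: (nat \<Rightarrow> real) \<Rightarrow> real. continuous_on S q \<and>
      trig_poly n (\<lambda>x. q (\<lambda>j. if j < n then sin (pi / (2 * K) * x j) else 0))}"
  have S: "s j \<in> {-1..1}" if "s \<in> S" for s j
    using that unfolding S_def by (auto dest!: spec[of _ j] split: if_splits)
  interpret function_ring_on R S
  proof
    show "compact S" unfolding S_def by (rule compact_product_real) auto
    show "continuous_on S f" if "f \<in> R" for f using that by (simp add: R_def)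
    show "(\<lambda>x. f x + g x) \<in> R" if "f \<in> R" "g \<in> R" for f g
      using that by (auto simp: R_def intro!: continuous_intros trig_poly.add)
    show "(\<lambda>x. f x * g x) \<in> R" if "f \<in> R" "g \<in> R" for f g
      using that by (auto simp: R_def intro!: continuous_intros trig_poly_mult)
    show "(\<lambda>_. c) \<in> R" for c by (simp add: R_def trig_poly_const)
    show "\<exists>f\<in>R. f x \<noteq> f y" if xy: "x \<in> S" "y \<in> S" "x \<noteq> y" for x y
    proof -
      obtain i where i: "x i \<noteq> y i" using xy(3) by (auto simp: fun_eq_iff)
      with xy have "i < n" unfolding S_def by (auto dest!: spec[of _ i] split: if_splits)
      then have "trig_poly n (\<lambda>x. if i < n then sin (pi / (2 * K) * x i) else 0)"
        using trig_poly_sin_coord[of i n "pi / (2 * K)"] by simp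
      moreover have "continuous_on S (\<lambda>s. s i)"
        using continuous_on_subset[OF continuous_on_product_coordinates[of i] subset_UNIV, of S] .
      ultimately have "(\<lambda>s. s i) \<in> R" unfolding R_def by (intro CollectI conjI)
      with i show ?thesis by (intro bexI[of _ "\<lambda>s. s i"])
    qed
  qed
  \<comment> \<open>This is \<open>g\<close> after the fold, written in the sine variables. It is
    continuous on \<open>S\<close> because \<open>arcsin\<close> is continuous on [-1, 1].\<close>
  define G where "G = (\<lambda>s :: nat \<Rightarrow> real. g (\<lambda>j. 2 * K / pi * arcsin (s j)))"
  have "continuous_on S (\<lambda>s. s j)" for j
    using continuous_on_subset[OF continuous_on_product_coordinates[of j] subset_UNIV] by blast
  then have "continuous_on S (\<lambda>s. (\<lambda>j. 2 * K / pi * arcsin (s j)))"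
    using S by (intro continuous_intros) auto
  then have "continuous_on S G"
    unfolding G_def by (rule continuous_on_compose2[OF g]) auto
  from Stone_Weierstrass_basic[OF this e] obtain q where q: "q \<in> R" "\<forall>s\<in>S. \<bar>G s - q s\<bar> < e"
    by blast
  show thesis
  proof
    let ?s = "\<lambda>x j. if j < n then sin (pi / (2 * K) * x j) else 0"
    show "trig_poly n (\<lambda>x. q (?s x))" using q(1) by (simp add: R_def)
    fix x :: "nat \<Rightarrow> real" assume x: "\<And>j. j \<ge> n \<Longrightarrow> x j = 0"
    have "?s x \<in> S" by (auto simp: S_def)
    then have "\<bar>G (?s x) - q (?s x)\<bar> < e" using q(2) by blast
    \<comment> \<open>At indices from \<open>n\<close> on both arguments of \<open>g\<close> vanish,
      since \<open>x j\<close>, \<open>sin 0\<close> and \<open>arcsin 0\<close> are 0.\<close>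
    moreover have "G (?s x) = g (fold_coords K x)"
      unfolding G_def fold_coords_def by (rule arg_cong[where f=g]) (auto simp: x fun_eq_iff)
    ultimately show "\<bar>g (fold_coords K x) - q (?s x)\<bar> < e" by simp
  qed
qed

section \<open>Control of the tails through one-dimensional marginals\<close>

definition tail_cutoff :: "real \<Rightarrow> real \<Rightarrow> real" where
  "tail_cutoff K x = min 1 (max 0 (\<bar>x\<bar> - K))"

lemma tail_cutoff_bounds: "0 \<le> tail_cutoff K x" "tail_cutoff K x \<le> 1"
  by (auto simp: tail_cutoff_def)

lemma tail_cutoff_eq_1: "K + 1 \<le> \<bar>x\<bar> \<Longrightarrow> tail_cutoff K x = 1"
  by (auto simp: tail_cutoff_def)

lemma tail_cutoff_measurable [measurable]: "tail_cutoff K \<in> borel_measurable borel"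
  unfolding tail_cutoff_def[abs_def] by measurable

text \<open>One-dimensional Levy continuity gives weak convergence of the marginals, and the cutoff
  is a bounded continuous test function. Being 1 where the absolute value is at least
  \<open>K + 1\<close>, it dominates a tail indicator.\<close>

lemma tail_cutoff_marginal_tendsto:
  fixes Y :: "nat \<Rightarrow> 'a \<Rightarrow> real" and W :: "'b \<Rightarrow> real"
  assumes M: "\<And>k. prob_space (M k)" and Q: "prob_space Q"
    and Y: "\<And>k. Y k \<in> borel_measurable (M k)" and W: "W \<in> borel_measurable Q"
    and conv: "\<And>c. (\<lambda>k. \<integral>\<omega>. cis (c * Y k \<omega>) \<partial>M k) \<longlonglongrightarrow> (\<integral>\<omega>. cis (c * W \<omega>) \<partial>Q)"
  shows "(\<lambda>k. \<integral>\<omega>. tail_cutoff K (Y k \<omega>) \<partial>M k) \<longlonglongrightarrow> (\<integral>\<omega>. tail_cutoff K (W \<omega>) \<partial>Q)"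
proof -
  let ?D = "\<lambda>k. distr (M k) borel (Y k)" and ?D' = "distr Q borel W"
  have rd: "real_distribution (?D k)" for k
    using prob_space.real_distribution_distr[OF M Y] .
  have rd': "real_distribution ?D'"
    using prob_space.real_distribution_distr[OF Q W] .
  have "char (?D k) c = (\<integral>\<omega>. cis (c * Y k \<omega>) \<partial>M k)" for k c
    unfolding char_def by (subst integral_distr[OF Y]) (simp_all add: cis_conv_exp)
  moreover have "char ?D' c = (\<integral>\<omega>. cis (c * W \<omega>) \<partial>Q)" for c
    unfolding char_def by (subst integral_distr[OF W]) (simp_all add: cis_conv_exp)
  ultimately have wc: "weak_conv_m ?D ?D'"
    by (intro levy_continuity[OF rd rd']) (simp add: conv)
  have "(\<lambda>k. integral\<^sup>L (?D k) (tail_cutoff K)) \<longlonglongrightarrow> integral\<^sup>L ?D' (tail_cutoff K)"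
    using tail_cutoff_bounds[of K]
    by (intro weak_conv_imp_integral_bdd_continuous_conv[OF rd rd' wc, where B=1])
       (auto simp: tail_cutoff_def[abs_def] intro!: continuous_intros)
  then show ?thesis by (simp add: integral_distr Y W)
qed

text \<open>Tightness of a single law: each real number is eventually below the cutoff level, and
  dominated convergence applies with bound 1.\<close>

lemma tail_cutoff_tendsto_0:
  fixes W :: "'b \<Rightarrow> real"
  assumes Q: "prob_space Q" and W: "W \<in> borel_measurable Q"
  shows "(\<lambda>m. \<integral>\<omega>. tail_cutoff (real m) (W \<omega>) \<partial>Q) \<longlonglongrightarrow> 0"
proof -
  interpret prob_space Q by fact
  have "(\<lambda>m. tail_cutoff (real m) y) \<longlonglongrightarrow> 0" for y
  proof (rule tendsto_eventually)
    have "tail_cutoff (real m) y = 0" if "nat \<lceil>\<bar>y\<bar>\<rceil> \<le> m" for m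
    proof -
      have "\<bar>y\<bar> \<le> real m" using that by (simp add: nat_ceiling_le_eq)
      then show ?thesis by (simp add: tail_cutoff_def)
    qed
    then show "\<forall>\<^sub>F m in sequentially. tail_cutoff (real m) y = 0"
      unfolding eventually_sequentially by blast
  qed
  then have "(\<lambda>m. \<integral>\<omega>. tail_cutoff (real m) (W \<omega>) \<partial>Q) \<longlonglongrightarrow> (\<integral>\<omega>. 0 \<partial>Q)"
    using W tail_cutoff_bounds
    by (intro integral_dominated_convergence[where w="\<lambda>_. 1"]) auto
  then show ?thesis by simp
qed

text \<open>Inside the cube of radius \<open>K + 1\<close> the fold is the identity. Outside it some
  coordinate has cutoff value 1, which pays for the trivial bound \<open>2 * B\<close>.\<close>

lemma fold_coords_error:
  fixes g :: "(nat \<Rightarrow> real) \<Rightarrow> real"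
  assumes B: "\<And>x. \<bar>g x\<bar> \<le> B" and K: "0 \<le> K" and x: "\<And>j. j \<ge> n \<Longrightarrow> x j = 0"
  shows "\<bar>g x - g (fold_coords (K + 1) x)\<bar> \<le> 2 * B * (\<Sum>j<n. tail_cutoff K (x j))"
proof (cases "\<forall>j. \<bar>x j\<bar> \<le> K + 1")
  case True
  then have "fold_coords (K + 1) x = x" using K by (intro fold_coords_eq) auto
  moreover have "0 \<le> B" using B[of x] by linarith
  ultimately show ?thesis by (simp add: sum_nonneg tail_cutoff_bounds)
next
  case False
  then obtain i where i: "K + 1 < \<bar>x i\<bar>" by (auto simp: not_le)
  have "i < n" using i x[of i] K by (cases "i < n") auto
  then have "tail_cutoff K (x i) \<le> (\<Sum>j<n. tail_cutoff K (x j))"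
    by (intro member_le_sum) (auto simp: tail_cutoff_bounds)
  then have "1 \<le> (\<Sum>j<n. tail_cutoff K (x j))" using tail_cutoff_eq_1[of K "x i"] i by simp
  moreover have "0 \<le> B" using B[of x] by linarith
  ultimately have "2 * B * 1 \<le> 2 * B * (\<Sum>j<n. tail_cutoff K (x j))"
    by (intro mult_left_mono) auto
  moreover have "\<bar>g x - g (fold_coords (K + 1) x)\<bar> \<le> 2 * B"
    using B[of x] B[of "fold_coords (K + 1) x"] by linarith
  ultimately show ?thesis by linarith
qed

section \<open>From trigonometric approximation to the continuity theorem\<close>

lemma expectation_trig_approx:
  fixes g :: "(nat \<Rightarrow> real) \<Rightarrow> real" and Y :: "'a \<Rightarrow> nat \<Rightarrow> real"
  assumes M: "prob_space M" and Y: "Y \<in> borel_measurable M" "\<And>\<omega> j. j \<ge> n \<Longrightarrow> Y \<omega> j = 0"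
    and g: "continuous_on UNIV g" and B: "\<And>x. \<bar>g x\<bar> \<le> B" and K: "0 \<le> K"
    and p: "trig_poly n p"
      "\<And>x. (\<And>j. j \<ge> n \<Longrightarrow> x j = 0) \<Longrightarrow> \<bar>g (fold_coords (K + 1) x) - p x\<bar> < e"
  shows "\<bar>(\<integral>\<omega>. g (Y \<omega>) \<partial>M) - (\<integral>\<omega>. p (Y \<omega>) \<partial>M)\<bar>
    \<le> 2 * B * (\<Sum>j<n. \<integral>\<omega>. tail_cutoff K (Y \<omega> j) \<partial>M) + e"
proof -
  interpret prob_space M by fact
  obtain B' where B': "\<And>x. \<bar>p x\<bar> \<le> B'" using trig_poly_bounded[OF p(1)] by blast
  have ig: "integrable M (\<lambda>\<omega>. g (Y \<omega>))" by (rule integrable_bounded_continuous[OF M Y(1) g B])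
  have ip: "integrable M (\<lambda>\<omega>. p (Y \<omega>))"
    by (rule integrable_bounded_continuous[OF M Y(1) trig_poly_continuous[OF p(1)] B'])
  note [measurable] = measurable_coord[OF Y(1)]
  have it: "integrable M (\<lambda>\<omega>. tail_cutoff K (Y \<omega> j))" for j
    using tail_cutoff_bounds by (intro integrable_const_bound[where B=1]) auto
  have "\<bar>(\<integral>\<omega>. g (Y \<omega>) \<partial>M) - (\<integral>\<omega>. p (Y \<omega>) \<partial>M)\<bar> = \<bar>\<integral>\<omega>. g (Y \<omega>) - p (Y \<omega>) \<partial>M\<bar>"
    using ig ip by simp
  also have "\<dots> \<le> (\<integral>\<omega>. \<bar>g (Y \<omega>) - p (Y \<omega>)\<bar> \<partial>M)"
    by (rule integral_abs_bound)
  also have "\<dots> \<le> (\<integral>\<omega>. 2 * B * (\<Sum>j<n. tail_cutoff K (Y \<omega> j)) + e \<partial>M)"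
  proof (rule integral_mono)
    fix \<omega>
    \<comment> \<open>Pass through \<open>g (fold_coords (K + 1) (Y \<omega>))\<close>: the cutoff
      sum bounds the folding error and \<open>e\<close> bounds the approximation error.\<close>
    show "\<bar>g (Y \<omega>) - p (Y \<omega>)\<bar> \<le> 2 * B * (\<Sum>j<n. tail_cutoff K (Y \<omega> j)) + e"
      using fold_coords_error[of g B K n "Y \<omega>", OF B K Y(2)] p(2)[of "Y \<omega>", OF Y(2)] by linarith
  qed (use ig ip it in auto)
  also have "\<dots> = 2 * B * (\<Sum>j<n. \<integral>\<omega>. tail_cutoff K (Y \<omega> j) \<partial>M) + e"
    using it by (simp add: prob_space)
  finally show ?thesis .
qed

text \<open>The hypothesis on characteristic functions is used twice: at multiples of unit vectors
  it controls the tails of all but finitely many laws, and at general vectors it gives convergence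
  for the trigonometric polynomial that replaces \<open>g\<close>.\<close>

theorem levy_continuity_vector:
  fixes Y :: "nat \<Rightarrow> 'a \<Rightarrow> nat \<Rightarrow> real" and W :: "'b \<Rightarrow> nat \<Rightarrow> real"
    and g :: "(nat \<Rightarrow> real) \<Rightarrow> real"
  assumes M: "\<And>k. prob_space (M k)" and Q: "prob_space Q"
    and Y: "\<And>k. Y k \<in> borel_measurable (M k)" and W: "W \<in> borel_measurable Q"
    and Y0: "\<And>k \<omega> j. j \<ge> n \<Longrightarrow> Y k \<omega> j = 0" and W0: "\<And>\<omega> j. j \<ge> n \<Longrightarrow> W \<omega> j = 0"
    and conv: "\<And>a. (\<lambda>k. \<integral>\<omega>. cis (\<Sum>j<n. a j * Y k \<omega> j) \<partial>M k)
                 \<longlonglongrightarrow> (\<integral>\<omega>. cis (\<Sum>j<n. a j * W \<omega> j) \<partial>Q)"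
    and g: "continuous_on UNIV g" and B: "\<And>x. \<bar>g x\<bar> \<le> B"
  shows "(\<lambda>k. \<integral>\<omega>. g (Y k \<omega>) \<partial>M k) \<longlonglongrightarrow> (\<integral>\<omega>. g (W \<omega>) \<partial>Q)"
proof (rule LIMSEQ_I)
  fix r :: real assume "0 < r"
  \<comment> \<open>Replacing \<open>g\<close> by \<open>p\<close> costs at most
    \<open>2 * e\<close> under each of the two laws, and comparing the expectations of
    \<open>p\<close> costs less than \<open>e\<close>: in total less than \<open>5 * e\<close>,
    hence less than \<open>r\<close>.\<close>
  define e where "e = r / 6"
  have e: "0 < e" using \<open>0 < r\<close> by (simp add: e_def)
  have marg: "(\<lambda>k. \<integral>\<omega>. tail_cutoff K (Y k \<omega> i) \<partial>M k) \<longlonglongrightarrow> (\<integral>\<omega>. tail_cutoff K (W \<omega> i) \<partial>Q)"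
    if "i < n" for i K
  proof (rule tail_cutoff_marginal_tendsto[OF M Q measurable_coord[OF Y] measurable_coord[OF W]])
    fix c :: real
    \<comment> \<open>The characteristic function of the \<open>i\<close>-th marginal is the joint
      one at \<open>c\<close> times the \<open>i\<close>-th unit vector.\<close>
    have "(\<Sum>j<n. (if j = i then c else 0) * x j) = c * x i" for x :: "nat \<Rightarrow> real"
      using that by (simp add: if_distrib[of "\<lambda>y. y * _"] cong: if_cong)
    then show "(\<lambda>k. \<integral>\<omega>. cis (c * Y k \<omega> i) \<partial>M k) \<longlonglongrightarrow> (\<integral>\<omega>. cis (c * W \<omega> i) \<partial>Q)"
      using conv[of "\<lambda>j. if j = i then c else 0"] by simp
  qed
  \<comment> \<open>The level \<open>m\<close> is chosen from the limit law alone; convergence of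
    the marginals carries the bound over to all large \<open>k\<close>. Only then is
    \<open>p\<close> chosen, as it depends on \<open>m\<close>.\<close>
  have "(\<lambda>m. 2 * B * (\<Sum>j<n. \<integral>\<omega>. tail_cutoff (real m) (W \<omega> j) \<partial>Q)) \<longlonglongrightarrow> 2 * B * (\<Sum>j<n. 0)"
    by (intro tendsto_intros tail_cutoff_tendsto_0 Q measurable_coord W)
  then have "\<forall>\<^sub>F m in sequentially. 2 * B * (\<Sum>j<n. \<integral>\<omega>. tail_cutoff (real m) (W \<omega> j) \<partial>Q) < e"
    using e by (intro order_tendstoD) auto
  then obtain m where m: "2 * B * (\<Sum>j<n. \<integral>\<omega>. tail_cutoff (real m) (W \<omega> j) \<partial>Q) < e"
    by (auto simp: eventually_sequentially)
  obtain p where p: "trig_poly n p"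
    "\<And>x. (\<And>j. j \<ge> n \<Longrightarrow> x j = 0) \<Longrightarrow> \<bar>g (fold_coords (real m + 1) x) - p x\<bar> < e"
    using trig_poly_approx_fold[OF g e] by metis
  have "(\<lambda>k. 2 * B * (\<Sum>j<n. \<integral>\<omega>. tail_cutoff (real m) (Y k \<omega> j) \<partial>M k))
      \<longlonglongrightarrow> 2 * B * (\<Sum>j<n. \<integral>\<omega>. tail_cutoff (real m) (W \<omega> j) \<partial>Q)"
    by (intro tendsto_intros marg) simp
  from order_tendstoD(2)[OF this m]
  have ev1: "\<forall>\<^sub>F k in sequentially. 2 * B * (\<Sum>j<n. \<integral>\<omega>. tail_cutoff (real m) (Y k \<omega> j) \<partial>M k) < e" .
  have ev2: "\<forall>\<^sub>F k in sequentially. dist (\<integral>\<omega>. p (Y k \<omega>) \<partial>M k) (\<integral>\<omega>. p (W \<omega>) \<partial>Q) < e"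
    by (rule tendstoD[OF trig_poly_tendsto[OF M Q Y W conv p(1)] e])
  have "\<forall>\<^sub>F k in sequentially. norm ((\<integral>\<omega>. g (Y k \<omega>) \<partial>M k) - (\<integral>\<omega>. g (W \<omega>) \<partial>Q)) < r"
    using ev1 ev2
  proof eventually_elim
    case (elim k)
    have "\<bar>(\<integral>\<omega>. g (Y k \<omega>) \<partial>M k) - (\<integral>\<omega>. p (Y k \<omega>) \<partial>M k)\<bar> \<le> e + e"
      using expectation_trig_approx[OF M[of k] Y Y0 g B _ p] elim(1) by fastforce
    moreover have "\<bar>(\<integral>\<omega>. g (W \<omega>) \<partial>Q) - (\<integral>\<omega>. p (W \<omega>) \<partial>Q)\<bar> \<le> e + e"
      using expectation_trig_approx[OF Q W W0 g B _ p] m by fastforce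
    ultimately show ?case using elim(2) unfolding dist_real_def e_def real_norm_def by linarith
  qed
  then show "\<exists>k0. \<forall>k\<ge>k0. norm ((\<integral>\<omega>. g (Y k \<omega>) \<partial>M k) - (\<integral>\<omega>. g (W \<omega>) \<partial>Q)) < r"
    by (simp add: eventually_sequentially)
qed

section \<open>Estimates for the kernel\<close>

text \<open>The gauge integrals over [0, 1] and [1, infinity) are glued along a null set.
  Nonnegativity upgrades the result to Lebesgue integrability, and reflection covers the negative
  half-line.\<close>

lemma integrable_piecewise_powr:
  fixes a b :: real
  assumes a: "-1 < a" and b: "b < -1"
  shows "integrable lborel (\<lambda>x. if \<bar>x\<bar> \<le> 1 then \<bar>x\<bar> powr a else \<bar>x\<bar> powr b)"
proof -
  define f where "f x = (if 0 \<le> x \<and> x \<le> 1 then x powr a else if 1 < x then x powr b else 0)" for x :: real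
  have [measurable]: "f \<in> borel_measurable borel" unfolding f_def[abs_def] by measurable
  have "f integrable_on {0..1}"
    by (rule integrable_spike_finite[of "{}", OF _ _ integrable_on_powr_from_0[OF a, of 1]])
       (auto simp: f_def)
  moreover have "(\<lambda>x. x powr b) integrable_on {1..}"
    using has_integral_powr_to_inf[OF b, of 1] by (auto simp: integrable_on_def)
  then have "f integrable_on {1..}"
    by (rule integrable_spike_finite[of "{1}", rotated 2]) (auto simp: f_def)
  moreover have "negligible ({0..1} \<inter> {1::real..})"
    by (rule negligible_subset[of "{1}"]) auto
  moreover have "{0..} = {0..1} \<union> {1::real..}" by auto
  ultimately have "f integrable_on {0..}" by (rule integrable_Un')
  then have "f integrable_on UNIV"
    by (rule integrable_spike_set) (auto simp: f_def)
  then have "f absolutely_integrable_on UNIV"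
    by (rule nonnegative_absolutely_integrable_1) (auto simp: f_def)
  then have f: "integrable lborel f"
    by (simp add: set_integrable_def integrable_completion)
  then have "integrable lborel (\<lambda>x. f (0 + (-1) * x))"
    by (intro lborel_integrable_real_affine) auto
  \<comment> \<open>The two summands overlap only at 0, where both vanish because
    \<open>0 powr a\<close> is 0.\<close>
  then have "integrable lborel (\<lambda>x. f x + f (-x))"
    using f by simp
  then show ?thesis
    by (rule Bochner_Integration.integrable_bound) (auto simp: f_def)
qed

text \<open>A majorant for kernels: \<open>k\<close> governs the singularity at 0, softened by one
  power of the modulus of \<open>x\<close> coming from \<open>cis (s * x) - 1\<close>, and
  \<open>l\<close> governs the decay at infinity. Separate indices allow \<open>k\<close> above and
  \<open>l\<close> below a whole range of Hurst values.\<close>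

definition powr_envelope :: "real \<Rightarrow> real \<Rightarrow> real \<Rightarrow> real \<Rightarrow> real" where
  "powr_envelope \<alpha> l k x =
     (if \<bar>x\<bar> \<le> 1 then \<bar>x\<bar> powr (1 - 1 / \<alpha> - k) else \<bar>x\<bar> powr (- (1 / \<alpha>) - l))"

lemma powr_envelope_nonneg: "0 \<le> powr_envelope \<alpha> l k x"
  by (simp add: powr_envelope_def)

lemma integrable_powr_envelope:
  assumes "0 < \<alpha>" "0 < l" "k < 1"
  shows "integrable lborel (\<lambda>x. powr_envelope \<alpha> l k x powr \<alpha>)"
proof -
  have "powr_envelope \<alpha> l k x powr \<alpha> =
      (if \<bar>x\<bar> \<le> 1 then \<bar>x\<bar> powr (\<alpha> * (1 - k) - 1) else \<bar>x\<bar> powr (- 1 - \<alpha> * l))" for x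
  proof -
    have "(1 - 1 / \<alpha> - k) * \<alpha> = \<alpha> * (1 - k) - 1" "(- (1 / \<alpha>) - l) * \<alpha> = - 1 - \<alpha> * l"
      using assms(1) by (simp_all add: field_simps)
    then show ?thesis by (simp add: powr_envelope_def powr_powr)
  qed
  then show ?thesis using assms by (simp add: integrable_piecewise_powr)
qed

text \<open>The derivative of \<open>y powr p\<close> in \<open>p\<close> is
  \<open>y powr p * ln y\<close>. The logarithm is absorbed by the strict gap between
  \<open>m\<close> and \<open>k\<close>, and \<open>exp z \<ge> 1 + z\<close> takes the place of the
  mean value theorem.\<close>

lemma powr_diff_exponent_bound:
  fixes y :: real
  assumes y: "1 \<le> y" and m: "p \<le> m" "q \<le> m" "m < k"
  shows "\<bar>y powr p - y powr q\<bar> \<le> \<bar>p - q\<bar> / (k - m) * y powr k"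
proof -
  have *: "\<bar>y powr p - y powr q\<bar> \<le> \<bar>p - q\<bar> / (k - m) * y powr k" if "p \<le> m" "q \<le> p" for p q
  proof -
    have "0 \<le> ln y" using y by simp
    have "y powr q = y powr p * y powr (q - p)"
      using y by (simp flip: powr_add)
    also have "y powr (q - p) \<ge> 1 - (p - q) * ln y"
      using y exp_ge_add_one_self[of "(q - p) * ln y"] by (simp add: powr_def algebra_simps)
    then have "y powr p * y powr (q - p) \<ge> y powr p * (1 - (p - q) * ln y)"
      by (intro mult_left_mono) auto
    finally have "y powr p - y powr q \<le> (p - q) * (y powr p * ln y)" by (simp add: algebra_simps)
    also have "\<dots> \<le> (p - q) * (y powr m * (y powr (k - m) / (k - m)))"
      using that y m(3) ln_powr_bound[of y "k - m"]
      by (intro mult_left_mono mult_mono powr_mono) auto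
    also have "y powr m * (y powr (k - m) / (k - m)) = y powr k / (k - m)"
      using y by (simp flip: powr_add)
    finally have "y powr p - y powr q \<le> \<bar>p - q\<bar> / (k - m) * y powr k"
      using that by simp
    moreover have "y powr q \<le> y powr p" using that y by (intro powr_mono) auto
    ultimately show ?thesis by simp
  qed
  show ?thesis
  proof (cases "q \<le> p")
    case True then show ?thesis using * m by blast
  next
    case False
    then show ?thesis using *[of q p] m by (simp add: abs_minus_commute)
  qed
qed

section \<open>Pointwise bounds for the kernel and for changes of its exponent\<close>

lemma cmod_cis_minus_1_le: "cmod (cis y - 1) \<le> \<bar>y\<bar>" "cmod (cis y - 1) \<le> 2"
  using iexp_approx1[of y 0] norm_triangle_ineq4[of "cis y" 1] by (simp_all add: cis_conv_exp)

lemma hms_kernel_measurable [measurable]: "hms_kernel \<alpha> h s \<in> borel_measurable borel"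
  unfolding hms_kernel_def[abs_def] by measurable

text \<open>This isolates the one factor that depends on \<open>h\<close>, so that a kernel and a
  difference of two kernels have the same shape. At 0 both sides vanish.\<close>

lemma hms_kernel_eq:
  "hms_kernel \<alpha> h s x = (cis (s * x) - 1) * complex_of_real (\<bar>x\<bar> powr (- (1 / \<alpha>)) * \<bar>x\<bar> powr (- h))"
proof -
  have "1 / \<bar>x\<bar> powr (1 / \<alpha> + h) = \<bar>x\<bar> powr (- (1 / \<alpha>)) * \<bar>x\<bar> powr (- h)"
    by (simp add: powr_minus powr_add field_simps)
  then show ?thesis unfolding hms_kernel_def
    by (metis (no_types, lifting) divide_inverse inverse_eq_divide of_real_inverse)
qed

text \<open>Here \<open>r\<close> stands for a power of the modulus of \<open>x\<close> or a
  difference of two such powers. Near 0 the linear bound on \<open>cis (s * x) - 1\<close> gives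
  \<open>S * c\<close>, farther out the bound 2 gives \<open>2 * d\<close>; their sum serves both
  regions.\<close>

lemma cmod_kernel_envelope:
  assumes s: "\<bar>s\<bar> \<le> S" and c: "0 \<le> c" "0 \<le> d"
    and r1: "\<bar>x\<bar> \<le> 1 \<Longrightarrow> x \<noteq> 0 \<Longrightarrow> \<bar>r\<bar> \<le> c * \<bar>x\<bar> powr (- k)"
    and r2: "1 < \<bar>x\<bar> \<Longrightarrow> \<bar>r\<bar> \<le> d * \<bar>x\<bar> powr (- l)"
  shows "cmod ((cis (s * x) - 1) * complex_of_real (\<bar>x\<bar> powr (- (1 / \<alpha>)) * r))
     \<le> (S * c + 2 * d) * powr_envelope \<alpha> l k x"
proof (cases "x = 0")
  case True
  then show ?thesis using powr_envelope_nonneg[of \<alpha> l k x] s c by (simp)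
next
  case x: False
  have S: "0 \<le> S" using s by linarith
  have eq: "cmod ((cis (s * x) - 1) * complex_of_real (\<bar>x\<bar> powr (- (1 / \<alpha>)) * r))
    = cmod (cis (s * x) - 1) * (\<bar>x\<bar> powr (- (1 / \<alpha>)) * \<bar>r\<bar>)"
    by (simp add: norm_mult abs_mult)
  show ?thesis
  proof (cases "\<bar>x\<bar> \<le> 1")
    case True
    have "cmod (cis (s * x) - 1) \<le> S * \<bar>x\<bar>"
    proof (rule order.trans[OF cmod_cis_minus_1_le(1)])
      show "\<bar>s * x\<bar> \<le> S * \<bar>x\<bar>" using s by (simp add: abs_mult mult_right_mono)
    qed
    then have "cmod (cis (s * x) - 1) * (\<bar>x\<bar> powr (- (1 / \<alpha>)) * \<bar>r\<bar>)
      \<le> (S * \<bar>x\<bar>) * (\<bar>x\<bar> powr (- (1 / \<alpha>)) * (c * \<bar>x\<bar> powr (- k)))"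
      using r1[OF True x] S by (intro mult_mono mult_nonneg_nonneg) auto
    also have "\<dots> = S * c * (\<bar>x\<bar> powr 1 * \<bar>x\<bar> powr (- (1 / \<alpha>)) * \<bar>x\<bar> powr (- k))"
      by simp
    also have "\<bar>x\<bar> powr 1 * \<bar>x\<bar> powr (- (1 / \<alpha>)) * \<bar>x\<bar> powr (- k) = powr_envelope \<alpha> l k x"
      using True by (simp only: powr_add[symmetric] powr_envelope_def if_True) (simp add: algebra_simps)
    also have "S * c * powr_envelope \<alpha> l k x \<le> (S * c + 2 * d) * powr_envelope \<alpha> l k x"
      using c powr_envelope_nonneg by (intro mult_right_mono) auto
    finally show ?thesis unfolding eq .
  next
    case False
    have "cmod (cis (s * x) - 1) * (\<bar>x\<bar> powr (- (1 / \<alpha>)) * \<bar>r\<bar>)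
      \<le> 2 * (\<bar>x\<bar> powr (- (1 / \<alpha>)) * (d * \<bar>x\<bar> powr (- l)))"
      using r2 False cmod_cis_minus_1_le(2)[of "s * x"] by (intro mult_mono mult_nonneg_nonneg) auto
    also have "\<dots> = 2 * d * (\<bar>x\<bar> powr (- (1 / \<alpha>)) * \<bar>x\<bar> powr (- l))"
      by simp
    also have "\<bar>x\<bar> powr (- (1 / \<alpha>)) * \<bar>x\<bar> powr (- l) = powr_envelope \<alpha> l k x"
      using False by (simp only: powr_add[symmetric] powr_envelope_def if_False) simp
    also have "2 * d * powr_envelope \<alpha> l k x \<le> (S * c + 2 * d) * powr_envelope \<alpha> l k x"
      using c S powr_envelope_nonneg by (intro mult_right_mono) auto
    finally show ?thesis unfolding eq .
  qed
qed

lemma hms_kernel_bound: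
  assumes "\<bar>s\<bar> \<le> S"
  shows "cmod (hms_kernel \<alpha> h s x) \<le> (S + 2) * powr_envelope \<alpha> h h x"
  using cmod_kernel_envelope[OF assms, of 1 1 x "\<bar>x\<bar> powr (- h)" h h \<alpha>]
  by (simp add: hms_kernel_eq)

text \<open>Linearity in the change of exponent is what brings in the Hoelder condition.
  \<open>powr_diff_exponent_bound\<close> is used with a base of at least 1 on both sides: the
  inverse modulus of \<open>x\<close> near 0, with gap \<open>k - M\<close>, and the modulus itself
  outside, with gap \<open>m - l\<close>.\<close>

lemma hms_kernel_diff_bound:
  assumes s: "\<bar>s\<bar> \<le> S" and lm: "l < m" "m \<le> h" "h \<le> M" "m \<le> h'" "h' \<le> M" "M < k"
  shows "cmod (hms_kernel \<alpha> h' s x - hms_kernel \<alpha> h s x)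
    \<le> (S / (k - M) + 2 / (m - l)) * \<bar>h' - h\<bar> * powr_envelope \<alpha> l k x"
proof -
  define r where "r = \<bar>x\<bar> powr (- h') - \<bar>x\<bar> powr (- h)"
  have "hms_kernel \<alpha> h' s x - hms_kernel \<alpha> h s x
     = (cis (s * x) - 1) * complex_of_real (\<bar>x\<bar> powr (- (1 / \<alpha>)) * r)"
    by (simp add: hms_kernel_eq r_def algebra_simps)
  moreover have "cmod ((cis (s * x) - 1) * complex_of_real (\<bar>x\<bar> powr (- (1 / \<alpha>)) * r))
    \<le> (S * (\<bar>h' - h\<bar> / (k - M)) + 2 * (\<bar>h' - h\<bar> / (m - l))) * powr_envelope \<alpha> l k x"
  proof (rule cmod_kernel_envelope[OF s])
    assume x: "\<bar>x\<bar> \<le> 1" "x \<noteq> 0"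
    have inv: "(1 / \<bar>x\<bar>) powr q = \<bar>x\<bar> powr (- q)" for q
      using x by (simp add: powr_divide powr_minus field_simps)
    show "\<bar>r\<bar> \<le> \<bar>h' - h\<bar> / (k - M) * \<bar>x\<bar> powr (- k)"
      using powr_diff_exponent_bound[of "1 / \<bar>x\<bar>" h' M h k] x lm by (simp add: inv r_def)
  next
    assume x: "1 < \<bar>x\<bar>"
    show "\<bar>r\<bar> \<le> \<bar>h' - h\<bar> / (m - l) * \<bar>x\<bar> powr (- l)"
      using powr_diff_exponent_bound[of "\<bar>x\<bar>" "- h'" "- m" "- h" "- l"] x lm
      by (simp add: r_def abs_minus_commute)
  qed (use lm in auto)
  moreover have "S * (\<bar>h' - h\<bar> / (k - M)) + 2 * (\<bar>h' - h\<bar> / (m - l))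
     = (S / (k - M) + 2 / (m - l)) * \<bar>h' - h\<bar>" by (simp add: algebra_simps)
  ultimately show ?thesis by simp
qed

section \<open>Perturbation of \<open>L\<^sup>p\<close> norms\<close>

text \<open>Convexity of the power, applied to \<open>a / (1 - \<theta>)\<close> and
  \<open>b / \<theta>\<close> with weights \<open>1 - \<theta>\<close> and \<open>\<theta>\<close>.
  As \<theta> tends to 0 the coefficient of the main term tends to 1, so nothing is lost in the
  limit.\<close>

lemma powr_add_convex_split:
  fixes a b \<theta> p :: real
  assumes "1 \<le> p" "0 < \<theta>" "\<theta> < 1" "0 \<le> a" "0 \<le> b"
  shows "(a + b) powr p \<le> (1 - \<theta>) powr (1 - p) * a powr p + \<theta> powr (1 - p) * b powr p"
proof -
  have ge1: "1 \<le> t powr (1 - p)" if "0 < t" "t < 1" for t :: real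
    using that assms(1) powr_mono'[of "1 - p" 0 t] by simp
  consider "a = 0" | "b = 0" | "0 < a" "0 < b" using assms by linarith
  then show ?thesis
  proof cases
    case 1
    then show ?thesis using mult_right_mono[OF ge1[of \<theta>], of "b powr p"] assms by simp
  next
    case 2
    then show ?thesis using mult_right_mono[OF ge1[of "1 - \<theta>"], of "a powr p"] assms by simp
  next
    case 3
    have split: "t * (c / t) powr p = t powr (1 - p) * c powr p" if "0 < t" "0 < c" for t c :: real
      using that by (simp add: powr_divide powr_diff)
    have "((1 - \<theta>) *\<^sub>R (a / (1 - \<theta>)) + \<theta> *\<^sub>R (b / \<theta>)) powr p
        \<le> (1 - \<theta>) * (a / (1 - \<theta>)) powr p + \<theta> * (b / \<theta>) powr p"
      using 3 assms by (intro convex_onD[OF powr_convex]) auto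
    then show ?thesis using 3 assms by (simp add: split)
  qed
qed

text \<open>This plays the role of Minkowski's inequality, with \<theta> left free to be matched to
  the size of \<open>B\<close>.\<close>

lemma integral_powr_cmod_add:
  fixes A B :: "real \<Rightarrow> complex"
  assumes p: "1 \<le> p" and [measurable]: "A \<in> borel_measurable borel" "B \<in> borel_measurable borel"
    and A: "integrable lborel (\<lambda>x. cmod (A x) powr p)"
    and B: "integrable lborel (\<lambda>x. cmod (B x) powr p)"
    and \<theta>: "0 < \<theta>" "\<theta> < 1"
  shows "integrable lborel (\<lambda>x. cmod (A x + B x) powr p)"
    and "(\<integral>x. cmod (A x + B x) powr p \<partial>lborel)
      \<le> (1 - \<theta>) powr (1 - p) * (\<integral>x. cmod (A x) powr p \<partial>lborel)
        + \<theta> powr (1 - p) * (\<integral>x. cmod (B x) powr p \<partial>lborel)"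
proof -
  let ?R = "\<lambda>x. (1 - \<theta>) powr (1 - p) * cmod (A x) powr p + \<theta> powr (1 - p) * cmod (B x) powr p"
  have le: "cmod (A x + B x) powr p \<le> ?R x" for x
  proof -
    have "cmod (A x + B x) powr p \<le> (cmod (A x) + cmod (B x)) powr p"
      using p by (intro powr_mono2 norm_triangle_ineq) auto
    also have "\<dots> \<le> ?R x" using p \<theta> by (intro powr_add_convex_split) auto
    finally show ?thesis .
  qed
  have R: "integrable lborel ?R" using A B by simp
  then show i: "integrable lborel (\<lambda>x. cmod (A x + B x) powr p)"
    by (rule Bochner_Integration.integrable_bound) (auto intro: order.trans[OF le])
  have "(\<integral>x. cmod (A x + B x) powr p \<partial>lborel) \<le> (\<integral>x. ?R x \<partial>lborel)"
    by (rule integral_mono[OF i R le])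
  then show "(\<integral>x. cmod (A x + B x) powr p \<partial>lborel)
      \<le> (1 - \<theta>) powr (1 - p) * (\<integral>x. cmod (A x) powr p \<partial>lborel)
        + \<theta> powr (1 - p) * (\<integral>x. cmod (B x) powr p \<partial>lborel)"
    using A B by simp
qed

lemma integrable_powr_dominated:
  fixes A :: "real \<Rightarrow> complex"
  assumes "0 \<le> p" and [measurable]: "A \<in> borel_measurable borel"
    and E: "integrable lborel (\<lambda>x. E x powr p)"
    and c: "0 \<le> c" and E0: "\<And>x. 0 \<le> E x" and le: "\<And>x. cmod (A x) \<le> c * E x"
  shows "integrable lborel (\<lambda>x. cmod (A x) powr p)"
    and "(\<integral>x. cmod (A x) powr p \<partial>lborel) \<le> c powr p * (\<integral>x. E x powr p \<partial>lborel)"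
proof -
  have le': "cmod (A x) powr p \<le> c powr p * E x powr p" for x
    using powr_mono2[OF assms(1) _ le] c E0 by (simp add: powr_mult)
  have cE: "integrable lborel (\<lambda>x. c powr p * E x powr p)" using E by simp
  then show i: "integrable lborel (\<lambda>x. cmod (A x) powr p)"
    by (rule Bochner_Integration.integrable_bound) (auto intro: order.trans[OF le'])
  show "(\<integral>x. cmod (A x) powr p \<partial>lborel) \<le> c powr p * (\<integral>x. E x powr p \<partial>lborel)"
    using integral_mono[OF i cE le'] by simp
qed

section \<open>Local asymptotics of the rescaled increments\<close>

lemma hms_kernel_scale:
  assumes "0 < \<delta>"
  shows "hms_kernel \<alpha> h (\<delta> * u) x = complex_of_real (\<delta> powr (1 / \<alpha> + h)) * hms_kernel \<alpha> h u (\<delta> * x)"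
proof -
  have "\<bar>\<delta> * x\<bar> powr (1 / \<alpha> + h) = \<delta> powr (1 / \<alpha> + h) * \<bar>x\<bar> powr (1 / \<alpha> + h)"
    using assms by (simp add: abs_mult powr_mult)
  moreover have "cis (\<delta> * u * x) = cis (u * (\<delta> * x))"
    by (rule arg_cong[where f=cis]) simp
  ultimately show ?thesis using assms unfolding hms_kernel_def by simp
qed

lemma hms_kernel_increment:
  "hms_kernel \<alpha> h (t + s) x - hms_kernel \<alpha> h t x = cis (t * x) * hms_kernel \<alpha> h s x"
  by (simp add: hms_kernel_def distrib_right cis_mult[symmetric] diff_divide_distrib[symmetric] algebra_simps)

text \<open>The factor \<open>cis (t * x)\<close> is common to all summands and has modulus 1. By
  self-similarity \<open>\<delta> powr (- h)\<close> cancels all of the scaling but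
  \<open>\<delta> powr (1 / \<alpha>)\<close>, whose power \<alpha> is the Jacobian of the
  substitution by \<open>\<delta> * x\<close>.\<close>

lemma kernel_sum_increment_scale:
  fixes a u :: "nat \<Rightarrow> real"
  assumes "0 < \<delta>" "0 < \<alpha>"
  shows "cmod (\<Sum>j<n. complex_of_real (a j * \<delta> powr (- h))
            * (hms_kernel \<alpha> h (t + \<delta> * u j) x - hms_kernel \<alpha> h t x)) powr \<alpha>
     = \<delta> * cmod (\<Sum>j<n. complex_of_real (a j) * hms_kernel \<alpha> h (u j) (\<delta> * x)) powr \<alpha>"
proof -
  let ?G = "\<Sum>j<n. complex_of_real (a j) * hms_kernel \<alpha> h (u j) (\<delta> * x)"
  have d: "\<delta> powr (- h) * \<delta> powr (1 / \<alpha> + h) = \<delta> powr (1 / \<alpha>)"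
    using assms by (simp flip: powr_add)
  have "complex_of_real (a j * \<delta> powr (- h)) * (hms_kernel \<alpha> h (t + \<delta> * u j) x - hms_kernel \<alpha> h t x)
     = (cis (t * x) * complex_of_real (\<delta> powr (1 / \<alpha>))) * (complex_of_real (a j) * hms_kernel \<alpha> h (u j) (\<delta> * x))" for j
    unfolding hms_kernel_increment hms_kernel_scale[OF assms(1)] d[symmetric] by simp
  then have "(\<Sum>j<n. complex_of_real (a j * \<delta> powr (- h))
            * (hms_kernel \<alpha> h (t + \<delta> * u j) x - hms_kernel \<alpha> h t x))
     = cis (t * x) * complex_of_real (\<delta> powr (1 / \<alpha>)) * ?G"
    unfolding sum_distrib_left by (rule sum.cong[OF refl])
  then have "cmod (\<Sum>j<n. complex_of_real (a j * \<delta> powr (- h))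
            * (hms_kernel \<alpha> h (t + \<delta> * u j) x - hms_kernel \<alpha> h t x)) = \<delta> powr (1 / \<alpha>) * cmod ?G"
    by (simp add: norm_mult)
  then show ?thesis using assms by (simp add: powr_mult powr_powr)
qed

text \<open>In the application \<open>f\<close> and \<open>I\<close> are the integrals for the
  perturbed and the unperturbed kernel, each estimated by the other. Multiplying \<open>lo\<close>
  by \<open>(1 - \<theta> \<delta>) powr (p - 1)\<close> solves it for
  \<open>f \<delta>\<close>.\<close>

lemma sandwich_tendsto:
  fixes f :: "real \<Rightarrow> real"
  assumes p: "1 \<le> p" and \<theta>: "(\<theta> \<longlongrightarrow> 0) F" and \<theta>01: "\<forall>\<^sub>F \<delta> in F. 0 < \<theta> \<delta> \<and> \<theta> \<delta> < 1"
    and up: "\<forall>\<^sub>F \<delta> in F. f \<delta> \<le> (1 - \<theta> \<delta>) powr (1 - p) * I + \<theta> \<delta> * K"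
    and lo: "\<forall>\<^sub>F \<delta> in F. I \<le> (1 - \<theta> \<delta>) powr (1 - p) * f \<delta> + \<theta> \<delta> * K"
  shows "(f \<longlongrightarrow> I) F"
proof (rule tendsto_sandwich)
  show "\<forall>\<^sub>F \<delta> in F. (1 - \<theta> \<delta>) powr (p - 1) * (I - \<theta> \<delta> * K) \<le> f \<delta>"
    using lo \<theta>01
  proof eventually_elim
    case (elim \<delta>)
    have "(1 - \<theta> \<delta>) powr (p - 1) * (I - \<theta> \<delta> * K)
        \<le> (1 - \<theta> \<delta>) powr (p - 1) * ((1 - \<theta> \<delta>) powr (1 - p) * f \<delta>)"
      using elim by (intro mult_left_mono) auto
    also have "\<dots> = f \<delta>" using elim by (simp flip: mult.assoc powr_add)
    finally show ?case .
  qed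
  have "((\<lambda>\<delta>. (1 - \<theta> \<delta>) powr (p - 1) * (I - \<theta> \<delta> * K)) \<longlongrightarrow> (1 - 0) powr (p - 1) * (I - 0 * K)) F"
    by (intro tendsto_intros \<theta>) auto
  then show "((\<lambda>\<delta>. (1 - \<theta> \<delta>) powr (p - 1) * (I - \<theta> \<delta> * K)) \<longlongrightarrow> I) F" by simp
  have "((\<lambda>\<delta>. (1 - \<theta> \<delta>) powr (1 - p) * I + \<theta> \<delta> * K) \<longlongrightarrow> (1 - 0) powr (1 - p) * I + 0 * K) F"
    by (intro tendsto_intros \<theta>) auto
  then show "((\<lambda>\<delta>. (1 - \<theta> \<delta>) powr (1 - p) * I + \<theta> \<delta> * K) \<longlongrightarrow> I) F" by simp
qed (rule up)

section \<open>Convergence of the integrals of the rescaled kernels\<close>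

lemma rescaled_kernel_integral_tendsto:
  fixes a u :: "nat \<Rightarrow> real" and H :: "real \<Rightarrow> real"
  assumes \<alpha>: "1 < \<alpha>" and m: "0 < m" and M: "M < 1"
    and HmM: "\<And>s. 0 \<le> s \<Longrightarrow> m \<le> H s \<and> H s \<le> M" and \<gamma>: "M < \<gamma>" and C: "0 < C"
    and holder: "\<And>s r. 0 \<le> s \<Longrightarrow> 0 \<le> r \<Longrightarrow> \<bar>H r - H s\<bar> \<le> C * \<bar>r - s\<bar> powr \<gamma>"
    and t: "0 \<le> t" and u: "\<And>j. j < n \<Longrightarrow> 0 \<le> u j"
  shows "((\<lambda>\<delta>. \<integral>x. cmod (\<Sum>j<n. complex_of_real (a j * \<delta> powr (- H t))
            * (hms_kernel \<alpha> (H (t + \<delta> * u j)) (t + \<delta> * u j) x - hms_kernel \<alpha> (H t) t x)) powr \<alpha> \<partial>lborel)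
    \<longlongrightarrow> (\<integral>x. cmod (\<Sum>j<n. complex_of_real (a j) * hms_kernel \<alpha> (H t) (u j) x) powr \<alpha> \<partial>lborel)) (at_right 0)"
proof -
  define h where "h = H t"
  have h: "m \<le> h" "h \<le> M" using HmM[OF t] by (auto simp: h_def)
  define U where "U = (\<Sum>j<n. u j)"
  have U: "u j \<le> U" if "j < n" for j
    unfolding U_def using that u by (intro member_le_sum) auto
  have U0: "0 \<le> U" unfolding U_def using u by (intro sum_nonneg) auto
  \<comment> \<open>Both indices stay inside (0, 1), so the envelope is in
    \<open>L^\<alpha>\<close>, yet lie strictly outside the range [m, M] of Hurst values, which
    leaves the gaps that absorb the logarithm.\<close>
  define l k where "l = m / 2" and "k = (M + 1) / 2"
  have lk: "0 < l" "l < m" "M < k" "k < 1" using m M by (auto simp: l_def k_def)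
  define D where "D = (t + U) / (k - M) + 2 / (m - l)"
  have D: "0 \<le> D" unfolding D_def using lk t U0 by auto
  define E where "E = powr_envelope \<alpha> l k"
  have E0: "0 \<le> E x" for x by (simp add: E_def powr_envelope_nonneg)
  have Eint: "integrable lborel (\<lambda>x. E x powr \<alpha>)"
    unfolding E_def using \<alpha> lk by (intro integrable_powr_envelope) auto

  define G where "G = (\<lambda>x. \<Sum>j<n. complex_of_real (a j) * hms_kernel \<alpha> h (u j) x)"
  define A where "A = (\<lambda>\<delta> x. \<Sum>j<n. complex_of_real (a j * \<delta> powr (- h))
            * (hms_kernel \<alpha> h (t + \<delta> * u j) x - hms_kernel \<alpha> h t x))"
  \<comment> \<open>Both kernels sit at the same time and differ only in the exponent. The term at
    time \<open>t\<close> contributes nothing, its exponent being \<open>h\<close> already.\<close>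
  define B where "B = (\<lambda>\<delta> x. \<Sum>j<n. complex_of_real (a j * \<delta> powr (- h))
            * (hms_kernel \<alpha> (H (t + \<delta> * u j)) (t + \<delta> * u j) x - hms_kernel \<alpha> h (t + \<delta> * u j) x))"
  have [measurable]: "G \<in> borel_measurable borel" "A \<delta> \<in> borel_measurable borel"
    "B \<delta> \<in> borel_measurable borel" for \<delta>
    unfolding G_def A_def B_def by measurable
  have AB: "(\<Sum>j<n. complex_of_real (a j * \<delta> powr (- H t))
            * (hms_kernel \<alpha> (H (t + \<delta> * u j)) (t + \<delta> * u j) x - hms_kernel \<alpha> (H t) t x)) = A \<delta> x + B \<delta> x"
    for \<delta> x
    unfolding A_def B_def h_def sum.distrib[symmetric]
    by (intro sum.cong refl) (simp add: algebra_simps)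

  \<comment> \<open>Without integrability the integral \<open>I\<close> would default to 0. The
    exponent is fixed here, so the envelope with both indices equal to \<open>h\<close>
    suffices.\<close>
  have Gint: "integrable lborel (\<lambda>x. cmod (G x) powr \<alpha>)"
  proof (rule integrable_powr_dominated(1))
    show "integrable lborel (\<lambda>x. powr_envelope \<alpha> h h x powr \<alpha>)"
      using \<alpha> h m M by (intro integrable_powr_envelope) auto
    show "0 \<le> (\<Sum>j<n. \<bar>a j\<bar> * (U + 2))" using U0 by (intro sum_nonneg) auto
    show "cmod (G x) \<le> (\<Sum>j<n. \<bar>a j\<bar> * (U + 2)) * powr_envelope \<alpha> h h x" for x
      unfolding G_def sum_distrib_right
    proof (rule sum_norm_le)
      fix j assume "j \<in> {..<n}"
      then have "\<bar>u j\<bar> \<le> U" using u U by auto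
      then have "\<bar>a j\<bar> * cmod (hms_kernel \<alpha> h (u j) x) \<le> \<bar>a j\<bar> * ((U + 2) * powr_envelope \<alpha> h h x)"
        by (intro mult_left_mono hms_kernel_bound) auto
      then show "cmod (complex_of_real (a j) * hms_kernel \<alpha> h (u j) x)
          \<le> \<bar>a j\<bar> * (U + 2) * powr_envelope \<alpha> h h x"
        by (simp add: norm_mult mult.assoc)
    qed
  qed (use \<alpha> powr_envelope_nonneg in auto)

  define I where "I = (\<integral>x. cmod (G x) powr \<alpha> \<partial>lborel)"
  have A: "integrable lborel (\<lambda>x. cmod (A \<delta> x) powr \<alpha>)" "(\<integral>x. cmod (A \<delta> x) powr \<alpha> \<partial>lborel) = I"
    if "0 < \<delta>" for \<delta>
  proof -
    have eq: "cmod (A \<delta> x) powr \<alpha> = \<delta> * cmod (G (0 + \<delta> * x)) powr \<alpha>" for x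
      using kernel_sum_increment_scale[OF that, where \<alpha>=\<alpha> and n=n and a=a and h=h and t=t and u=u and x=x] \<alpha> by (simp add: A_def G_def)
    show "integrable lborel (\<lambda>x. cmod (A \<delta> x) powr \<alpha>)"
      unfolding eq using lborel_integrable_real_affine[OF Gint, of \<delta> 0] that by simp
    show "(\<integral>x. cmod (A \<delta> x) powr \<alpha> \<partial>lborel) = I"
      unfolding eq I_def using lborel_integral_real_affine[of \<delta> "\<lambda>x. cmod (G x) powr \<alpha>" 0] that by simp
  qed

  define c where "c = (\<Sum>j<n. \<bar>a j\<bar> * (D * (C * u j powr \<gamma>)))"
  have c: "0 \<le> c" unfolding c_def using D C by (intro sum_nonneg mult_nonneg_nonneg) auto
  \<comment> \<open>The convexity weight is chosen of the order of the perturbation itself: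
    then \<open>\<theta>\<^sup>1\<^sup>-\<^sup>\<alpha> \<integral> |B|\<^sup>\<alpha> = O(\<theta>)\<close>.\<close>
  define \<theta> where "\<theta> = (\<lambda>\<delta>::real. \<delta> powr (\<gamma> - h))"
  define K where "K = c powr \<alpha> * (\<integral>x. E x powr \<alpha> \<partial>lborel)"
  have Bbound: "cmod (B \<delta> x) \<le> (\<theta> \<delta> * c) * E x" if \<delta>: "0 < \<delta>" "\<delta> < 1" for \<delta> x
  proof -
    have "cmod (B \<delta> x) \<le> (\<Sum>j<n. \<theta> \<delta> * (\<bar>a j\<bar> * (D * (C * u j powr \<gamma>))) * E x)"
      unfolding B_def
    proof (rule sum_norm_le)
      fix j assume "j \<in> {..<n}"
      then have j: "0 \<le> u j" "u j \<le> U" using u U by auto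
      define s where "s = t + \<delta> * u j"
      \<comment> \<open>The restriction \<open>\<delta> < 1\<close> keeps all times below
        \<open>t + U\<close>, so that the constant \<open>D\<close> is independent of
        \<delta>.\<close>
      have "\<delta> * u j \<le> u j" using \<delta> j by (simp add: mult_left_le_one_le)
      then have s: "0 \<le> s" "\<bar>s\<bar> \<le> t + U" using \<delta> j t by (auto simp: s_def)
      have "cmod (hms_kernel \<alpha> (H s) s x - hms_kernel \<alpha> h s x) \<le> D * \<bar>H s - h\<bar> * E x"
        unfolding D_def E_def using lk h HmM[OF s(1)] s by (intro hms_kernel_diff_bound) auto
      also have "\<bar>H s - h\<bar> \<le> C * (\<delta> powr \<gamma> * u j powr \<gamma>)"
        using holder[OF t s(1)] \<delta> j by (simp add: s_def h_def abs_mult powr_mult)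
      finally have k: "cmod (hms_kernel \<alpha> (H s) s x - hms_kernel \<alpha> h s x)
          \<le> D * (C * (\<delta> powr \<gamma> * u j powr \<gamma>)) * E x"
        using D E0 by (simp add: mult_left_mono mult_right_mono)
      have "cmod (complex_of_real (a j * \<delta> powr (- h)) * (hms_kernel \<alpha> (H s) s x - hms_kernel \<alpha> h s x))
        = \<bar>a j\<bar> * \<delta> powr (- h) * cmod (hms_kernel \<alpha> (H s) s x - hms_kernel \<alpha> h s x)"
        by (simp add: norm_mult abs_mult)
      also have "\<dots> \<le> \<bar>a j\<bar> * \<delta> powr (- h) * (D * (C * (\<delta> powr \<gamma> * u j powr \<gamma>)) * E x)"
        by (rule mult_left_mono[OF k]) auto
      also have "\<dots> = (\<delta> powr (- h) * \<delta> powr \<gamma>) * (\<bar>a j\<bar> * (D * (C * u j powr \<gamma>))) * E x"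
        by simp
      also have "\<delta> powr (- h) * \<delta> powr \<gamma> = \<theta> \<delta>"
        by (simp add: \<theta>_def flip: powr_add)
      finally show "cmod (complex_of_real (a j * \<delta> powr (- h))
          * (hms_kernel \<alpha> (H (t + \<delta> * u j)) (t + \<delta> * u j) x - hms_kernel \<alpha> h (t + \<delta> * u j) x))
        \<le> \<theta> \<delta> * (\<bar>a j\<bar> * (D * (C * u j powr \<gamma>))) * E x"
        unfolding s_def .
    qed
    also have "\<dots> = (\<theta> \<delta> * c) * E x"
      unfolding c_def sum_distrib_left sum_distrib_right ..
    finally show ?thesis .
  qed
  have \<theta>0: "0 \<le> \<theta> \<delta>" for \<delta> by (simp add: \<theta>_def)
  have B: "integrable lborel (\<lambda>x. cmod (B \<delta> x) powr \<alpha>)"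
    "(\<integral>x. cmod (B \<delta> x) powr \<alpha> \<partial>lborel) \<le> \<theta> \<delta> powr \<alpha> * K"
    if \<delta>: "0 < \<delta>" "\<delta> < 1" for \<delta>
  proof -
    note dom = integrable_powr_dominated[of \<alpha> "B \<delta>" E "\<theta> \<delta> * c", OF _ _ Eint _ E0 Bbound[OF \<delta>]]
    show "integrable lborel (\<lambda>x. cmod (B \<delta> x) powr \<alpha>)"
      using \<alpha> c \<theta>0 by (intro dom(1)) auto
    have "(\<integral>x. cmod (B \<delta> x) powr \<alpha> \<partial>lborel) \<le> (\<theta> \<delta> * c) powr \<alpha> * (\<integral>x. E x powr \<alpha> \<partial>lborel)"
      using \<alpha> c \<theta>0 by (intro dom(2)) auto
    then show "(\<integral>x. cmod (B \<delta> x) powr \<alpha> \<partial>lborel) \<le> \<theta> \<delta> powr \<alpha> * K"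
      using c \<theta>0 by (simp add: K_def powr_mult)
  qed

  have ev: "\<forall>\<^sub>F \<delta> in at_right (0::real). 0 < \<delta> \<and> \<delta> < 1"
    by (auto simp: eventually_at_right_field intro: exI[of _ 1])
  have \<gamma>h: "0 < \<gamma> - h" using \<gamma> h by simp
  have \<theta>01: "0 < \<theta> \<delta>" "\<theta> \<delta> < 1" if "0 < \<delta>" "\<delta> < 1" for \<delta>
    using that \<gamma>h powr_less_mono2[of "\<gamma> - h" \<delta> 1] by (auto simp: \<theta>_def)
  have \<theta>K: "\<theta> \<delta> powr (1 - \<alpha>) * (\<integral>x. cmod (B \<delta> x) powr \<alpha> \<partial>lborel) \<le> \<theta> \<delta> * K"
    if "0 < \<delta>" "\<delta> < 1" for \<delta>
  proof -
    have "\<theta> \<delta> powr (1 - \<alpha>) * (\<integral>x. cmod (B \<delta> x) powr \<alpha> \<partial>lborel)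
        \<le> \<theta> \<delta> powr (1 - \<alpha>) * (\<theta> \<delta> powr \<alpha> * K)"
      by (rule mult_left_mono[OF B(2)[OF that]]) simp
    also have "\<dots> = \<theta> \<delta> * K" using \<theta>01[OF that] by (simp flip: mult.assoc powr_add)
    finally show ?thesis .
  qed
  have "((\<lambda>\<delta>. \<integral>x. cmod (A \<delta> x + B \<delta> x) powr \<alpha> \<partial>lborel) \<longlongrightarrow> I) (at_right 0)"
  proof (rule sandwich_tendsto)
    show "1 \<le> \<alpha>" using \<alpha> by simp
    show "(\<theta> \<longlongrightarrow> 0) (at_right 0)"
      unfolding \<theta>_def using \<gamma>h ev
      by (intro tendsto_zero_powrI[where b="\<gamma> - h"]) (auto intro: eventually_mono tendsto_intros)
    show "\<forall>\<^sub>F \<delta> in at_right 0. 0 < \<theta> \<delta> \<and> \<theta> \<delta> < 1"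
      using ev by eventually_elim (simp add: \<theta>01)
    show "\<forall>\<^sub>F \<delta> in at_right 0. (\<integral>x. cmod (A \<delta> x + B \<delta> x) powr \<alpha> \<partial>lborel)
        \<le> (1 - \<theta> \<delta>) powr (1 - \<alpha>) * I + \<theta> \<delta> * K"
      using ev
    proof eventually_elim
      case (elim \<delta>)
      then show ?case
        using integral_powr_cmod_add(2)[OF _ _ _ A(1) B(1) \<theta>01, of \<delta> \<delta> \<delta>] \<alpha> A(2)[of \<delta>] \<theta>K[of \<delta>] by simp
    qed
    show "\<forall>\<^sub>F \<delta> in at_right 0. I \<le> (1 - \<theta> \<delta>) powr (1 - \<alpha>) * (\<integral>x. cmod (A \<delta> x + B \<delta> x) powr \<alpha> \<partial>lborel)
        + \<theta> \<delta> * K"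
      using ev
    proof eventually_elim
      case (elim \<delta>)
      have AB: "integrable lborel (\<lambda>x. cmod (A \<delta> x + B \<delta> x) powr \<alpha>)"
        using integral_powr_cmod_add(1)[OF _ _ _ A(1) B(1) \<theta>01, of \<delta> \<delta> \<delta>] \<alpha> elim by simp
      have mB: "integrable lborel (\<lambda>x. cmod (- B \<delta> x) powr \<alpha>)" using B(1) elim by simp
      \<comment> \<open>The reverse comparison treats \<open>A\<close> as a perturbation of
        \<open>A + B\<close> by \<open>- B\<close>.\<close>
      have "(\<integral>x. cmod (A \<delta> x + B \<delta> x + - B \<delta> x) powr \<alpha> \<partial>lborel)
          \<le> (1 - \<theta> \<delta>) powr (1 - \<alpha>) * (\<integral>x. cmod (A \<delta> x + B \<delta> x) powr \<alpha> \<partial>lborel)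
            + \<theta> \<delta> powr (1 - \<alpha>) * (\<integral>x. cmod (- B \<delta> x) powr \<alpha> \<partial>lborel)"
        using \<alpha> elim by (intro integral_powr_cmod_add(2)[OF _ _ _ AB mB] \<theta>01) auto
      then show ?case using A(2)[of \<delta>] \<theta>K[of \<delta>] elim by simp
    qed
  qed
  then show ?thesis unfolding AB unfolding I_def G_def h_def .
qed

section \<open>Characteristic functions of the rescaled increments and the limit in law\<close>

lemma rescaled_increments_char:
  fixes a u :: "nat \<Rightarrow> real"
  assumes law: "has_rhmsp_law P \<alpha> H X" and t: "0 \<le> t" and u: "\<And>j. j < n \<Longrightarrow> 0 \<le> u j" and \<delta>: "0 < \<delta>"
  shows "(\<integral>\<omega>. cis (\<Sum>j<n. a j * (\<delta> powr (- h) * (X (t + \<delta> * u j) \<omega> - X t \<omega>))) \<partial>P) =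
    complex_of_real (exp (- (\<integral>x. cmod (\<Sum>j<n. complex_of_real (a j * \<delta> powr (- h))
       * (hms_kernel \<alpha> (H (t + \<delta> * u j)) (t + \<delta> * u j) x - hms_kernel \<alpha> (H t) t x)) powr \<alpha> \<partial>lborel)))"
proof -
  define s where "s = (\<lambda>j. if j < n then t + \<delta> * u j else t)"
  define b where "b = (\<lambda>j. if j < n then a j * \<delta> powr (- h) else - (\<Sum>j<n. a j * \<delta> powr (- h)))"
  \<comment> \<open>the extra node \<open>s n = t\<close> carries all the terms \<open>- X t\<close>\<close>
  have "\<forall>j<Suc n. 0 \<le> s j" using t u \<delta> by (auto simp: s_def)
  with law have "(\<integral>\<omega>. cis (\<Sum>j<Suc n. b j * X (s j) \<omega>) \<partial>P) =
     complex_of_real (exp (- (\<integral>x. \<bar>cmod (\<Sum>j<Suc n. complex_of_real (b j) * hms_kernel \<alpha> (H (s j)) (s j) x)\<bar> powr \<alpha> \<partial>lborel)))"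
    unfolding has_rhmsp_law_def by blast
  moreover have "(\<Sum>j<Suc n. b j * X (s j) \<omega>) = (\<Sum>j<n. a j * (\<delta> powr (- h) * (X (t + \<delta> * u j) \<omega> - X t \<omega>)))" for \<omega>
    by (simp add: b_def s_def sum_subtractf right_diff_distrib sum_distrib_right mult.assoc)
  moreover have "(\<Sum>j<Suc n. complex_of_real (b j) * hms_kernel \<alpha> (H (s j)) (s j) x)
      = (\<Sum>j<n. complex_of_real (a j * \<delta> powr (- h))
       * (hms_kernel \<alpha> (H (t + \<delta> * u j)) (t + \<delta> * u j) x - hms_kernel \<alpha> (H t) t x))" for x
    by (simp add: b_def s_def sum_subtractf right_diff_distrib sum_distrib_right mult.assoc)
  ultimately show ?thesis by simp
qed

theorem mainTheorem5:
  fixes \<alpha> :: real and H :: "real \<Rightarrow> real" and C \<gamma> :: real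
    and P :: "'a measure" and X :: "real \<Rightarrow> 'a \<Rightarrow> real"
    and Q :: "'b measure" and Z :: "real \<Rightarrow> 'b \<Rightarrow> real" and t :: real
  assumes "1 < \<alpha>" and "\<alpha> < 2"
    and "bdd_below (H ` {0..})" and "bdd_above (H ` {0..})"
    and "0 < Inf (H ` {0..})" and "Sup (H ` {0..}) < 1"
    and "0 < C" and "Sup (H ` {0..}) < \<gamma>"
    and "\<forall>s\<ge>0. \<forall>r\<ge>0. \<bar>H r - H s\<bar> \<le> C * \<bar>r - s\<bar> powr \<gamma>"
    and "prob_space P" and "has_rhmsp_law P \<alpha> H X"
    and "prob_space Q" and "has_rhmsp_law Q \<alpha> (\<lambda>_. H t) Z"
    and "0 \<le> t"
  shows "fdd_converges_at_right0 P (\<lambda>\<delta> u \<omega>. \<delta> powr (- H t) * (X (t + \<delta> * u) \<omega> - X t \<omega>)) Q Z"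
  unfolding fdd_converges_at_right0_def
proof (intro allI impI)
  fix n :: nat and u :: "nat \<Rightarrow> real" and g :: "(nat \<Rightarrow> real) \<Rightarrow> real"
  assume u: "\<forall>j<n. 0 \<le> u j" and g: "continuous_on UNIV g \<and> bounded (range g)"
  then obtain b where b: "\<And>x. \<bar>g x\<bar> \<le> b" by (auto simp: bounded_iff)
  have Hb: "Inf (H ` {0..}) \<le> H s \<and> H s \<le> Sup (H ` {0..})" if "0 \<le> s" for s
    using that assms(3,4) by (auto intro: cInf_lower cSup_upper)
  let ?Y = "\<lambda>\<delta> \<omega> j. if j < n then \<delta> powr (- H t) * (X (t + \<delta> * u j) \<omega> - X t \<omega>) else 0"
  let ?W = "\<lambda>\<omega> j. if j < n then Z (u j) \<omega> else 0"
  show "((\<lambda>\<delta>. \<integral>\<omega>. g (?Y \<delta> \<omega>) \<partial>P) \<longlongrightarrow> (\<integral>\<omega>. g (?W \<omega>) \<partial>Q)) (at_right 0)"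
  \<comment> \<open>One-sided limits at 0 can be tested along positive null sequences, the form in
    which the continuity theorem is stated.\<close>
  proof (rule tendsto_at_right_sequentially[of 0 1])
    fix S :: "nat \<Rightarrow> real" assume S: "\<And>k. 0 < S k" "S \<longlonglongrightarrow> 0"
    have S_right: "filterlim S (at_right 0) sequentially"
      using S by (intro tendsto_imp_filterlim_at_right) auto
    show "(\<lambda>k. \<integral>\<omega>. g (?Y (S k) \<omega>) \<partial>P) \<longlonglongrightarrow> (\<integral>\<omega>. g (?W \<omega>) \<partial>Q)"
    proof (rule levy_continuity_vector[where n=n and M="\<lambda>_. P" and g=g and Y="\<lambda>k. ?Y (S k)" and W="?W"])
      show "?Y (S k) \<in> borel_measurable P" for k
      proof (rule measurable_coordinatewise_then_product)
        fix j
        have "X (t + S k * u j) \<in> borel_measurable P" if "j < n"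
          using that assms(11,14) u S(1)[of k] by (auto simp: has_rhmsp_law_def less_imp_le)
        moreover have "X t \<in> borel_measurable P" using assms(11,14) by (auto simp: has_rhmsp_law_def)
        ultimately show "(\<lambda>\<omega>. ?Y (S k) \<omega> j) \<in> borel_measurable P" by (cases "j < n") auto
      qed
      show "?W \<in> borel_measurable Q"
      proof (rule measurable_coordinatewise_then_product)
        fix j
        show "(\<lambda>\<omega>. ?W \<omega> j) \<in> borel_measurable Q"
          using assms(13) u by (cases "j < n") (auto simp: has_rhmsp_law_def)
      qed
      fix a :: "nat \<Rightarrow> real"
      let ?F = "\<lambda>\<delta>. \<integral>x. cmod (\<Sum>j<n. complex_of_real (a j * \<delta> powr (- H t))
            * (hms_kernel \<alpha> (H (t + \<delta> * u j)) (t + \<delta> * u j) x - hms_kernel \<alpha> (H t) t x)) powr \<alpha> \<partial>lborel"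
      let ?G = "\<integral>x. cmod (\<Sum>j<n. complex_of_real (a j) * hms_kernel \<alpha> (H t) (u j) x) powr \<alpha> \<partial>lborel"
      have "(?F \<longlongrightarrow> ?G) (at_right 0)"
        using assms u Hb by (intro rescaled_kernel_integral_tendsto
            [where m="Inf (H ` {0..})" and M="Sup (H ` {0..})" and \<gamma>=\<gamma> and C=C]) auto
      from filterlim_compose[OF this S_right]
      have "(\<lambda>k. complex_of_real (exp (- ?F (S k)))) \<longlonglongrightarrow> complex_of_real (exp (- ?G))"
        by (intro tendsto_of_real tendsto_exp tendsto_minus)
      moreover have "(\<integral>\<omega>. cis (\<Sum>j<n. a j * ?Y (S k) \<omega> j) \<partial>P) = complex_of_real (exp (- ?F (S k)))" for k
        using rescaled_increments_char[OF assms(11,14) _ S(1), where n=n and u=u and a=a and h="H t"] u by simp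
      \<comment> \<open>The constant Hurst function in the law of \<open>Z\<close> freezes the
        exponent at \<open>H t\<close>, which yields exactly the limiting integral.\<close>
      moreover have "(\<integral>\<omega>. cis (\<Sum>j<n. a j * ?W \<omega> j) \<partial>Q) = complex_of_real (exp (- ?G))"
        using assms(13) u by (simp add: has_rhmsp_law_def)
      ultimately show "(\<lambda>k. \<integral>\<omega>. cis (\<Sum>j<n. a j * ?Y (S k) \<omega> j) \<partial>P)
          \<longlonglongrightarrow> (\<integral>\<omega>. cis (\<Sum>j<n. a j * ?W \<omega> j) \<partial>Q)" by simp
    qed (use assms g b in auto)
  qed simp
qed

end
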